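(* Let $d\ge1$, let $u:\mathbb{Z}^d\to\mathbb{C}$ be compactly (i.e. finitely) supported and $\hat u=\mathcal{F}u$. Let $J$ be a positive integer and let $\lambda_1,\dots,\lambda_J\in\Lambda$. Let $f=\mathcal{F}^{-1}\hat f$, where $$\hat f(k)=\hat u(k)\prod_{j=1}^{J}(\phi(k)-\lambda_j),\qquad k\in T^d.$$ Then $f$ is compactly supported on $\mathbb{Z}^d$, and its far-field amplitudes $a^-(\omega,\lambda)$ and $a^+(\omega,\lambda)$ vanish identically in $\omega\in\mathbb{S}^{d-1}$ for each $\lambda=\lambda_j$, $j=1,\dots,J$.
   Context: Discrete Laplacian: $\Delta\psi(x)=\sum_{x'\in\mathbb{Z}^d,\,|x'-x|=1}\psi(x')$, $x\in\mathbb{Z}^d$. The discrete Helmholtz equation is $\Delta\psi-\lambda\psi=f$ on $\mathbb{Z}^d$. Let $\Lambda=\{\zeta\in\mathbb{R}:\ 2d-4<|\zeta|<2d\}$, $T^d=\mathbb{R}^d/2\pi\mathbb{Z}^d$, $\phi(k)=2\sum_{i=1}^d\cos k_i$, and $\Gamma(\lambda)=\{k\in T^d:\phi(k)=\lambda\}$. Discrete Fourier transform: $\hat u(k)=\mathcal{F}u(k)=(2\pi)^{-d/2}\sum_{x\in\mathbb{Z}^d}u(x)e^{-ik\cdot x}$, $k\in T^d$, with inverse $\mathcal{F}^{-1}\hat u(x)=(2\pi)^{-d/2}\int_{T^d}\hat u(k)e^{ik\cdot x}\,dk$, $x\in\mathbb{Z}^d$. For $\lambda\in\Lambda$ and $\omega\in\mathbb{S}^{d-1}$,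 $\kappa(\omega,\lambda)$ denotes the unique point of $\Gamma(\lambda)$ with $\nabla\phi(\kappa)/|\nabla\phi(\kappa)|=\omega$, and $\mu(\omega,\lambda)=\kappa(\omega,\lambda)\cdot\omega$ (for $x\in\mathbb{Z}^d\setminus\{0\}$ and $\omega=x/|x|$ one has $e^{\pm i\mu(\omega,\lambda)|x|}=e^{\pm i\kappa(\omega,\lambda)\cdot x}$, which is well defined for $\kappa\in T^d$). For compactly supported $f$ and $\lambda\in\Lambda$ let $\psi^\pm(x)=\lim_{\nu\to\lambda\pm i0}\big((\Delta-\nu)^{-1}f\big)(x)$, $x\in\mathbb{Z}^d$, where $(\Delta-\nu)^{-1}:\ell^2(\mathbb{Z}^d)\to\ell^2(\mathbb{Z}^d)$ for $\operatorname{Im}\nu\ne0$. The far-field amplitudes $a^\pm(\omega,\lambda)$ of $f$ are the functions, continuous (indeed smooth) in $\omega\in\mathbb{S}^{d-1}$, determined by the asymptotic formula $$\psi^\pm(x)=\frac{e^{\pm i\mu(\omega,\lambda)|x|}}{|x|^{(d-1)/2}}\,a^\pm(\omega,\lambda)+O\big(|x|^{-(d+1)/2}\big),\qquad \omega=x/|x|,\ |x|\to\infty,\ x\in\mathbb{Z}^d,$$ with remainder uniform in $\omega$. (The directions $x/|x|$, $x\in\mathbb{Z}^d\setminus\{0\}$, are dense in $\mathbb{S}^{d-1}$, and $a^\pm$ is extended to all of $\mathbb{S}^{d-1}$ by continuity.) *)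

theory Defs
  imports "HOL-Analysis.Analysis" "HOL-Library.Landau_Symbols"
begin

text \<open>The lattice $\mathbb{Z}^d$ is the type \<open>int ^ 'n\<close> with $d =$ \<open>CARD('n)\<close>.\<close>

definition emb :: "int ^ 'n::finite \<Rightarrow> real ^ 'n" where
  "emb x = (\<chi> i. real_of_int (x $ i))"

definition discrete_laplacian :: "(int ^ 'n::finite \<Rightarrow> complex) \<Rightarrow> int ^ 'n \<Rightarrow> complex" where
  "discrete_laplacian \<psi> x = (\<Sum>x' \<in> {x'. norm (emb x' - emb x) = 1}. \<psi> x')"

definition ell2 :: "(int ^ 'n::finite \<Rightarrow> complex) set" where
  "ell2 = {\<psi>. (\<lambda>x. (cmod (\<psi> x))\<^sup>2) summable_on UNIV}"

text \<open>For non-real \<open>\<nu>\<close> the operator $\Delta - \nu$ is a bijection of \<open>ell2\<close> onto itself;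
  for real \<open>\<nu>\<close> the value of \<open>resolvent\<close> is not used.\<close>

definition resolvent :: "complex \<Rightarrow> (int ^ 'n::finite \<Rightarrow> complex) \<Rightarrow> int ^ 'n \<Rightarrow> complex" where
  "resolvent \<nu> = inv_into ell2 (\<lambda>\<psi> x. discrete_laplacian \<psi> x - \<nu> * \<psi> x)"

definition Lambda :: "nat \<Rightarrow> real set" where
  "Lambda d = {\<zeta>. 2 * real d - 4 < \<bar>\<zeta>\<bar> \<and> \<bar>\<zeta>\<bar> < 2 * real d}"

text \<open>The torus $\mathbb{R}^d / 2\pi\mathbb{Z}^d$ is represented by a half-open fundamental cube, so that
  each class has exactly one representative.\<close>

definition torus :: "(real ^ 'n::finite) set" where
  "torus = {k. \<forall>i. - pi \<le> k $ i \<and> k $ i < pi}"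

definition phi :: "real ^ 'n::finite \<Rightarrow> real" where
  "phi k = 2 * (\<Sum>i\<in>UNIV. cos (k $ i))"

definition Gamma_surf :: "real \<Rightarrow> (real ^ 'n::finite) set" where
  "Gamma_surf \<zeta> = {k \<in> torus. phi k = \<zeta>}"

definition fourier :: "(int ^ 'n::finite \<Rightarrow> complex) \<Rightarrow> real ^ 'n \<Rightarrow> complex" where
  "fourier u k = of_real ((2 * pi) powr (- real CARD('n) / 2)) *
     (\<Sum>\<^sub>\<infinity>x\<in>UNIV. u x * exp (- \<i> * of_real (k \<bullet> emb x)))"

definition inverse_fourier :: "(real ^ 'n::finite \<Rightarrow> complex) \<Rightarrow> int ^ 'n \<Rightarrow> complex" where
  "inverse_fourier g x = of_real ((2 * pi) powr (- real CARD('n) / 2)) *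
     (LBINT k:torus. g k * exp (\<i> * of_real (k \<bullet> emb x)))"

text \<open>For \<open>\<zeta> \<in> Lambda CARD('n)\<close> and \<open>\<omega>\<close> on the unit sphere such a point exists and is unique.\<close>

definition kappa :: "real ^ 'n::finite \<Rightarrow> real \<Rightarrow> real ^ 'n" where
  "kappa \<omega> \<zeta> = (THE k. k \<in> Gamma_surf \<zeta> \<and>
     (\<exists>g. (GDERIV phi k :> g) \<and> g \<noteq> 0 \<and> g /\<^sub>R norm g = \<omega>))"

text \<open>\<open>mu\<close> depends on the representative chosen for \<open>kappa\<close>, but
  $e^{\pm i \mu(\omega,\zeta)|x|} = e^{\pm i \kappa(\omega,\zeta)\cdot x}$ with $\omega = x/|x|$ does not,
  for lattice points $x \neq 0$.\<close>

definition mu :: "real ^ 'n::finite \<Rightarrow> real \<Rightarrow> real" where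
  "mu \<omega> \<zeta> = kappa \<omega> \<zeta> \<bullet> \<omega>"

text \<open>Below, \<open>s = 1\<close> and \<open>s = - 1\<close> stand for the superscripts $+$ and $-$.
  The limit $\nu \to \zeta \pm i0$ is taken along $\nu = \zeta \pm i\epsilon$, $\epsilon \downarrow 0$.\<close>

definition is_limit_solution ::
  "real \<Rightarrow> real \<Rightarrow> (int ^ 'n::finite \<Rightarrow> complex) \<Rightarrow> (int ^ 'n \<Rightarrow> complex) \<Rightarrow> bool" where
  "is_limit_solution s \<zeta> f \<psi> \<longleftrightarrow>
     (\<forall>x. ((\<lambda>\<epsilon>. resolvent (Complex \<zeta> (s * \<epsilon>)) f x) \<longlongrightarrow> \<psi> x) (at_right 0))"

text \<open>The filter is $|x| \to \infty$ on the lattice, so the remainder is uniform in the direction.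
  Only the values of \<open>a\<close> on the unit sphere matter, and these are determined by \<open>s\<close>, \<open>\<zeta>\<close>, \<open>f\<close>,
  since lattice directions are dense.\<close>

definition is_far_field_amplitude ::
  "real \<Rightarrow> real \<Rightarrow> (int ^ 'n::finite \<Rightarrow> complex) \<Rightarrow> (real ^ 'n \<Rightarrow> complex) \<Rightarrow> bool" where
  "is_far_field_amplitude s \<zeta> f a \<longleftrightarrow>
     continuous_on (sphere 0 1) a \<and>
     (\<exists>\<psi>. is_limit_solution s \<zeta> f \<psi> \<and>
       (\<lambda>x. \<psi> x -
          (let r = norm (emb x); \<omega> = emb x /\<^sub>R r in
             exp (\<i> * of_real (s * mu \<omega> \<zeta> * r)) / of_real (r powr ((real CARD('n) - 1) / 2)) * a \<omega>))
       \<in> O[filtercomap (\<lambda>x. norm (emb x)) at_top](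
           \<lambda>x. of_real (norm (emb x) powr (- (real CARD('n) + 1) / 2))))"

end

theory Submission
  imports Defs
begin

text \<open>
  Passing from \<open>f\<close> to its far field means dividing \<open>\<F> f\<close> by \<open>\<phi> - \<lambda>\<close>, and the far field
  is produced by the singularity of this quotient on the level surface \<open>\<phi> = \<lambda>\<close>.
  For \<open>\<lambda> = \<lambda>\<^sub>j\<close> the factor \<open>\<phi> - \<lambda>\<^sub>j\<close> contained in \<open>\<F> f\<close> cancels the divisor, so there is no
  singularity and no far field.

  In detail: multiplication by \<open>\<phi> - z\<close> on the torus is \<open>\<Delta> - z\<close> on the lattice
  (\<open>inverse_fourier_mult_phi\<close>), and \<open>\<Delta> - z\<close> preserves finite support. Hence the inverse
  transform of \<open>\<F> u\<close> times any finite product of such factors has finite support; this applies to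
  \<open>f\<close> and to the function \<open>v\<close> obtained by omitting the factor with index \<open>j\<close>, for which
  \<open>f = (\<Delta> - \<lambda>\<^sub>j) v\<close>. Write \<open>g\<close> for the transform of \<open>v\<close>. For nonreal \<open>\<nu>\<close>,
  \<open>(\<Delta> - \<nu>)\<^sup>-\<^sup>1 f\<close> is the inverse transform of \<open>g (\<phi> - \<lambda>\<^sub>j) / (\<phi> - \<nu>)\<close>: this function is
  square summable by Bessel's inequality (\<open>inverse_fourier_in_ell2\<close>), and it is the only square
  summable solution since the symmetric operator \<open>\<Delta>\<close> has no nonreal eigenvalue
  (\<open>no_nonreal_eigenfunction_ell2\<close>). For \<open>\<nu> = \<lambda>\<^sub>j \<plusminus> \<i>\<epsilon>\<close> the quotient
  \<open>(\<phi> - \<lambda>\<^sub>j) / (\<phi> - \<nu>)\<close> is bounded by 1 and tends to 1 off the level surface, which is a null set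
  (\<open>level_set_null\<close>). Dominated convergence gives \<open>\<psi>\<^sup>\<plusminus> = v\<close>
  (\<open>is_limit_solution_inverse_fourier\<close>).

  So both limit solutions have finite support, and the zero function is an amplitude. Conversely,
  outside the support of \<open>v\<close> the asymptotic formula says that an amplitude is \<open>O(1/|x|)\<close> along
  lattice directions \<open>x/|x|\<close>; since every direction is a limit of such directions with
  \<open>|x| \<rightarrow> \<infinity>\<close>, continuity forces the amplitude to vanish (\<open>far_field_amplitude_zero\<close>).
\<close>

section \<open>Integration over the torus\<close>

lemma vec_lambda_measurable [measurable]:
  "(vec_lambda :: ('n::finite \<Rightarrow> real) \<Rightarrow> real ^ 'n) \<in> (\<Pi>\<^sub>M i\<in>UNIV. lborel) \<rightarrow>\<^sub>M borel"
proof (subst borel_measurable_euclidean_space, rule ballI)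
  fix b :: "real ^ 'n" assume "b \<in> Basis"
  then obtain i where "b = axis i 1"
    by (auto simp: Basis_vec_def)
  then show "(\<lambda>x. vec_lambda x \<bullet> b) \<in> borel_measurable (\<Pi>\<^sub>M i\<in>UNIV. lborel)"
    by (simp add: inner_axis)
qed

text \<open>The one-coordinate-at-a-time form of Lebesgue measure on \<open>real ^ 'n\<close>: it makes the
  Fubini theorems for finite products available, both for the orthogonality of
  exponentials and for the nullity of level sets.\<close>

lemma lborel_cart_eq_distr_PiM:
  "(lborel :: (real ^ 'n::finite) measure) = distr (\<Pi>\<^sub>M i\<in>UNIV. lborel) borel vec_lambda"
proof (rule lborel_eqI)
  interpret product_sigma_finite "\<lambda>i::'n. lborel :: real measure"
    by standard
  fix l u :: "real ^ 'n" assume le: "\<And>b. b \<in> Basis \<Longrightarrow> l \<bullet> b \<le> u \<bullet> b"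
  have le': "l $ i \<le> u $ i" for i
    using le[of "axis i 1"] by (simp add: inner_axis)
  have "emeasure (distr (\<Pi>\<^sub>M i\<in>UNIV. lborel) borel vec_lambda) (box l u) =
      emeasure (\<Pi>\<^sub>M i\<in>UNIV. lborel) (vec_lambda -` box l u \<inter> space (\<Pi>\<^sub>M i\<in>(UNIV::'n set). lborel))"
    by (rule emeasure_distr) auto
  also have "vec_lambda -` box l u \<inter> space (\<Pi>\<^sub>M i\<in>(UNIV::'n set). lborel)
      = (\<Pi>\<^sub>E i\<in>UNIV. {l $ i <..< u $ i})"
    by (auto simp: mem_box_cart space_PiM PiE_iff)
  also have "emeasure (\<Pi>\<^sub>M i\<in>UNIV. lborel) \<dots> = (\<Prod>i\<in>UNIV. ennreal (u $ i - l $ i))"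
    by (subst emeasure_PiM) (auto intro!: prod.cong simp: le')
  also have "\<dots> = ennreal (\<Prod>i\<in>UNIV. (u - l) $ i)"
    by (simp add: prod_ennreal le')
  also have "(\<Prod>i\<in>UNIV. (u - l) $ i) = (\<Prod>b\<in>Basis. (u - l) \<bullet> b)"
    unfolding Basis_vec_def
    by (simp add: prod.UNION_disjoint axis_eq_axis inner_axis)
  finally show "emeasure (distr (\<Pi>\<^sub>M i\<in>UNIV. lborel) borel vec_lambda) (box l u) =
      ennreal (\<Prod>b\<in>Basis. (u - l) \<bullet> b)" .
qed simp

lemma torus_measurable [measurable]: "(torus :: (real ^ 'n::finite) set) \<in> sets borel"
proof -
  have "(torus :: (real ^ 'n) set) = (\<Inter>i. (\<lambda>k. k $ i) -` {-pi..<pi})"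
    by (auto simp: torus_def)
  also have "\<dots> \<in> sets borel"
    by (intro sets.countable_INT'' borel_measurable_vimage)
      (auto intro!: measurable_sets_borel[of _ borel] borel_measurable_continuous_onI continuous_intros)
  finally show ?thesis .
qed

abbreviation torus_measure :: "(real ^ 'n::finite) measure" where
  "torus_measure \<equiv> restrict_space lborel torus"

lemma finite_torus_measure: "finite_measure (torus_measure :: (real ^ 'n::finite) measure)"
proof
  have "emeasure lborel (torus :: (real ^ 'n) set) \<le> emeasure lborel (cbox (\<chi> i. -pi) (\<chi> i::'n. pi))"
    by (intro emeasure_mono) (auto simp: torus_def mem_box_cart less_imp_le)
  also have "\<dots> < \<infinity>"
    using emeasure_lborel_cbox_finite by blast
  finally show "emeasure (torus_measure :: (real ^ 'n) measure) (space torus_measure) \<noteq> \<infinity>"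
    by (simp add: emeasure_restrict_space space_restrict_space)
qed

lemma integrable_torus:
  fixes g :: "real ^ 'n::finite \<Rightarrow> complex"
  assumes "g \<in> borel_measurable borel" and "\<And>k. cmod (g k) \<le> B"
  shows "integrable torus_measure g"
proof -
  interpret finite_measure "torus_measure :: (real ^ 'n) measure"
    by (rule finite_torus_measure)
  show ?thesis
    by (rule integrable_const_bound[of _ B])
      (use assms in \<open>auto intro!: measurable_restrict_space1\<close>)
qed

lemma phi_measurable [measurable]: "(phi :: real ^ 'n::finite \<Rightarrow> real) \<in> borel_measurable borel"
  unfolding phi_def by (intro borel_measurable_continuous_onI continuous_intros)

text \<open>With all coordinates but one fixed, the equation \<open>\<phi> = c\<close> prescribes the cosine of the
  remaining one, which leaves at most two values in a period. So every line in that coordinate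
  direction meets the part of the level set in the fundamental cube in a null set, and Fubini applies.\<close>

lemma level_set_null:
  "AE k in (torus_measure :: (real ^ 'n::finite) measure). phi k \<noteq> c"
proof -
  interpret product_sigma_finite "\<lambda>i::'n. lborel :: real measure"
    by standard
  obtain j :: 'n where True by blast
  define A :: "(real ^ 'n) set" where "A = torus \<inter> phi -` {c :: real}"
  have A [measurable]: "A \<in> sets borel"
    unfolding A_def by (intro sets.Int torus_measurable measurable_sets_borel[OF phi_measurable]) simp
  have "emeasure lborel A =
      emeasure (\<Pi>\<^sub>M i\<in>UNIV. lborel) (vec_lambda -` A \<inter> space (\<Pi>\<^sub>M i\<in>(UNIV::'n set). lborel))"
    by (subst lborel_cart_eq_distr_PiM) (rule emeasure_distr, auto)
  also have "\<dots> = (\<integral>\<^sup>+ x. indicator (vec_lambda -` A \<inter> space (\<Pi>\<^sub>M i\<in>(UNIV::'n set). lborel)) x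
      \<partial>(\<Pi>\<^sub>M i\<in>(UNIV::'n set). lborel))"
    by (rule nn_integral_indicator[symmetric]) measurable
  also have "\<dots> = (\<integral>\<^sup>+ x. indicator A (vec_lambda x) \<partial>(\<Pi>\<^sub>M i\<in>(UNIV::'n set). lborel))"
    by (intro nn_integral_cong) (auto split: split_indicator)
  also have "\<dots> = (\<integral>\<^sup>+ x. indicator A (vec_lambda x) \<partial>(\<Pi>\<^sub>M i\<in>insert j (UNIV - {j}). lborel))"
    by (simp add: insert_absorb)
  also have "\<dots> = (\<integral>\<^sup>+ x. (\<integral>\<^sup>+ y. indicator A (vec_lambda (x(j := y))) \<partial>lborel)
      \<partial>(\<Pi>\<^sub>M i\<in>UNIV - {j}. lborel))"
    by (rule product_nn_integral_insert) (simp_all add: insert_absorb)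
  also have "\<dots> = (\<integral>\<^sup>+ x. 0 \<partial>(\<Pi>\<^sub>M i\<in>UNIV - {j}. (lborel :: real measure)))"
  proof (rule nn_integral_cong)
    fix x :: "'n \<Rightarrow> real"
    \<comment> \<open>The value that the equation \<open>\<phi> = c\<close> prescribes for the cosine of coordinate \<open>j\<close>.\<close>
    define b where "b = c / 2 - (\<Sum>i\<in>UNIV - {j}. cos (x i))"
    have fin: "y \<in> {arccos b, - arccos b}" if "vec_lambda (x(j := y)) \<in> A" for y
    proof -
      from that have y: "- pi \<le> y" "y < pi" and p: "phi (vec_lambda (x(j := y))) = c"
        by (auto simp: A_def torus_def dest: spec[of _ j])
      have "(\<Sum>i\<in>UNIV. cos ((x(j := y)) i)) = cos y + (\<Sum>i\<in>UNIV - {j}. cos (x i))"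
        by (subst sum.remove[of _ j]) auto
      with p have "cos y = b"
        by (simp add: phi_def b_def)
      with y show ?thesis
        using arccos_cos[of y] arccos_cos2[of y] by (cases "y \<ge> 0") auto
    qed
    have "AE y in lborel. y \<notin> {arccos b, - arccos b}"
      by (intro AE_not_in countable_imp_null_set_lborel) auto
    then have "AE y in lborel. indicator A (vec_lambda (x(j := y))) = (0::ennreal)"
      by eventually_elim (use fin in \<open>auto split: split_indicator\<close>)
    then show "(\<integral>\<^sup>+ y. indicator A (vec_lambda (x(j := y))) \<partial>lborel) = 0"
      by (simp cong: nn_integral_cong_AE)
  qed
  finally have "A \<in> null_sets lborel"
    by auto
  then have "AE k in lborel. k \<notin> A"
    by (rule AE_not_in)
  then show ?thesis
    by (subst AE_restrict_space_iff) (auto simp: A_def elim: eventually_mono)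
qed

definition wave :: "int ^ 'n::finite \<Rightarrow> real ^ 'n \<Rightarrow> complex" where
  "wave x k = exp (\<i> * of_real (k \<bullet> emb x))"

lemma emb_add: "emb (x + y) = emb x + emb y"
  by (simp add: emb_def vec_eq_iff)

lemma emb_minus: "emb (- x) = - emb x"
  by (simp add: emb_def vec_eq_iff)

lemma wave_add: "wave (x + y) k = wave x k * wave y k"
  by (simp add: wave_def emb_add inner_add_right ring_distribs exp_add)

lemma wave_minus: "wave (- x) k = cnj (wave x k)"
  by (simp add: wave_def emb_minus exp_cnj)

lemma norm_wave [simp]: "cmod (wave x k) = 1"
  unfolding wave_def by (rule norm_exp_i_times)

lemma wave_measurable [measurable]: "wave x \<in> borel_measurable borel"
  unfolding wave_def by (intro borel_measurable_continuous_onI continuous_intros)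

lemma wave_eq_prod:
  "wave m k = (\<Prod>i\<in>UNIV. exp (\<i> * of_real (k $ i * of_int (m $ i))))"
  by (simp add: wave_def inner_vec_def emb_def sum_distrib_left flip: exp_sum)

lemma integral_exp_period:
  fixes n :: int
  shows "(\<integral>y. indicator {-pi..<pi} y *\<^sub>R exp (\<i> * of_real (y * of_int n)) \<partial>lborel)
    = (if n = 0 then 2 * of_real pi else 0)"
proof -
  have "(\<integral>y. indicator {-pi..<pi} y *\<^sub>R exp (\<i> * of_real (y * of_int n)) \<partial>lborel)
    = (\<integral>y. indicator {-pi..pi} y *\<^sub>R exp (\<i> * of_real (y * of_int n)) \<partial>lborel)"
    \<comment> \<open>The cube is half open, while the fundamental theorem of calculus wants a closed interval.\<close>
  proof (rule integral_cong_AE)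
    show "AE y in lborel. indicator {-pi..<pi} y *\<^sub>R exp (\<i> * of_real (y * of_int n))
      = indicator {-pi..pi} y *\<^sub>R exp (\<i> * of_real (y * of_int n))"
      using AE_lborel_singleton[of pi] by eventually_elim (auto split: split_indicator)
  qed measurable
  also have "\<dots> = (if n = 0 then 2 * of_real pi else 0)"
  proof (cases "n = 0")
    case True
    then show ?thesis
      using integral_FTC_Icc[of "-pi" pi "\<lambda>y. of_real y :: complex" "\<lambda>_. 1"]
      by (auto intro!: derivative_eq_intros simp: has_vector_derivative_of_real scaleR_conv_of_real)
  next
    case False
    define F where "F y = exp (\<i> * of_real (y * of_int n)) / (\<i> * of_int n)" for y :: real
    have "(F has_vector_derivative exp (\<i> * of_real (y * of_int n))) (at y within {-pi..pi})" for y
    proof -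
      have "((\<lambda>z. exp (\<i> * (z * of_int n)) / (\<i> * of_int n)) has_field_derivative
         exp (\<i> * (of_real y * of_int n))) (at (of_real y))"
        using False by (auto intro!: derivative_eq_intros simp: algebra_simps)
      then show ?thesis
        using field_vector_diff_chain_within[of of_real 1 y "{-pi..pi}"]
        unfolding F_def o_def
        by (auto intro!: has_vector_derivative_real_field[THEN has_vector_derivative_at_within])
    qed
    then have "(\<integral>y. indicator {-pi..pi} y *\<^sub>R exp (\<i> * of_real (y * of_int n)) \<partial>lborel) = F pi - F (-pi)"
      by (intro integral_FTC_Icc continuous_intros) auto
    also have "\<dots> = 0"
    proof -
      have "exp (\<i> * of_real (pi * of_int n)) = exp (\<i> * of_real (- pi * of_int n))"
        unfolding exp_eq by (rule exI[of _ n]) (simp add: algebra_simps)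
      then show ?thesis by (simp add: F_def)
    qed
    finally show ?thesis using False by simp
  qed
  finally show ?thesis .
qed

text \<open>Orthogonality of the characters of the torus: the integral splits into a product of
  one-dimensional ones, each over a full period.\<close>

lemma integral_wave:
  fixes m :: "int ^ 'n::finite"
  shows "(\<integral>k. wave m k \<partial>torus_measure)
    = (if m = 0 then of_real ((2 * pi) ^ CARD('n)) else 0)"
proof -
  interpret product_sigma_finite "\<lambda>i::'n. lborel :: real measure"
    by standard
  let ?e = "\<lambda>i y. indicator {-pi..<pi} y *\<^sub>R exp (\<i> * of_real (y * of_int (m $ i)))"
  have ind: "indicator torus k = (\<Prod>i\<in>UNIV. indicator {-pi..<pi} (k $ i) :: complex)"
    for k :: "real ^ 'n"
    by (auto simp: torus_def indicator_def)
  have "(\<integral>k. wave m k \<partial>torus_measure) = (\<integral>k. indicator torus k *\<^sub>R wave m k \<partial>lborel)"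
    by (rule integral_restrict_space) auto
  also have "\<dots> = (\<integral>k. (\<Prod>i\<in>UNIV. ?e i (k $ i)) \<partial>lborel)"
    by (intro Bochner_Integration.integral_cong refl)
      (simp add: wave_eq_prod scaleR_conv_of_real prod.distrib ind of_real_indicator)
  also have "\<dots> = (\<integral>k. (\<Prod>i\<in>UNIV. ?e i (vec_lambda k $ i)) \<partial>(\<Pi>\<^sub>M i\<in>UNIV. lborel))"
    by (subst lborel_cart_eq_distr_PiM) (rule integral_distr, measurable)
  also have "\<dots> = (\<Prod>i\<in>UNIV. integral\<^sup>L lborel (?e i))"
    unfolding vec_lambda_beta
  proof (rule product_integral_prod)
    fix i :: 'n
    show "integrable lborel (?e i)"
    proof (rule integrableI_bounded_set_indicator[where B = 1])
      show "emeasure lborel {-pi..<pi} < \<infinity>" by simp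
    qed auto
  qed simp
  also have "\<dots> = (\<Prod>i\<in>UNIV. if m $ i = 0 then 2 * of_real pi else 0)"
    by (simp only: integral_exp_period)
  also have "\<dots> = (if m = 0 then of_real ((2 * pi) ^ CARD('n)) else 0)"
    by (auto simp: vec_eq_iff)
  finally show ?thesis .
qed

section \<open>The Fourier transform on the lattice\<close>

definition fourier_const :: "'n::finite itself \<Rightarrow> complex" where
  "fourier_const _ = of_real ((2 * pi) powr (- real CARD('n) / 2))"

lemma fourier_const_sq:
  "fourier_const TYPE('n::finite) * fourier_const TYPE('n) * of_real ((2 * pi) ^ CARD('n)) = 1"
proof -
  have "b powr (- real CARD('n) / 2) * b powr (- real CARD('n) / 2) * b ^ CARD('n) = 1"
    if "b > 0" for b :: real
    using that by (simp flip: powr_add powr_realpow)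
  from this[of "2 * pi"]
  have "(2 * pi) powr (- real CARD('n) / 2) * (2 * pi) powr (- real CARD('n) / 2) * (2 * pi) ^ CARD('n) = 1"
    by simp
  then show ?thesis
    unfolding fourier_const_def of_real_mult[symmetric] by simp
qed

lemma cnj_fourier_const [simp]: "cnj (fourier_const TYPE('n::finite)) = fourier_const TYPE('n)"
  by (simp add: fourier_const_def)

lemma inverse_fourier_eq:
  fixes g :: "real ^ 'n::finite \<Rightarrow> complex"
  shows "inverse_fourier g x = fourier_const TYPE('n) * (\<integral>k. g k * wave x k \<partial>torus_measure)"
  by (simp add: inverse_fourier_def set_lebesgue_integral_def integral_restrict_space
    wave_def fourier_const_def)

lemma fourier_eq:
  fixes u :: "int ^ 'n::finite \<Rightarrow> complex"
  assumes "finite {x. u x \<noteq> 0}"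
  shows "fourier u k = fourier_const TYPE('n) * (\<Sum>x | u x \<noteq> 0. u x * wave (- x) k)"
proof -
  have "(\<Sum>\<^sub>\<infinity>x\<in>UNIV. u x * exp (- \<i> * of_real (k \<bullet> emb x)))
      = (\<Sum>\<^sub>\<infinity>x\<in>{x. u x \<noteq> 0}. u x * wave (- x) k)"
    by (rule infsum_cong_neutral) (auto simp: wave_def emb_minus)
  then show ?thesis
    using assms by (simp add: fourier_def fourier_const_def)
qed

lemma inverse_fourier_fourier:
  fixes u :: "int ^ 'n::finite \<Rightarrow> complex"
  assumes fin: "finite {x. u x \<noteq> 0}"
  shows "inverse_fourier (fourier u) y = u y"
proof -
  let ?c = "fourier_const TYPE('n)"
  have "(\<integral>k. fourier u k * wave y k \<partial>torus_measure)
      = (\<integral>k. (\<Sum>x | u x \<noteq> 0. ?c * u x * wave (y - x) k) \<partial>torus_measure)"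
    using fin by (simp add: fourier_eq sum_distrib_left sum_distrib_right mult_ac
        diff_conv_add_uminus[of y] wave_add del: add_uminus_conv_diff)
  also have "\<dots> = (\<Sum>x | u x \<noteq> 0. ?c * u x * (\<integral>k. wave (y - x) k \<partial>torus_measure))"
    by (subst Bochner_Integration.integral_sum)
      (auto intro!: integrable_mult_right integrable_torus[of _ 1])
  also have "\<dots> = (\<Sum>x | u x \<noteq> 0. if x = y then ?c * u x * of_real ((2 * pi) ^ CARD('n)) else 0)"
    by (intro sum.cong) (auto simp: integral_wave)
  also have "\<dots> = ?c * u y * of_real ((2 * pi) ^ CARD('n))"
    using fin by (simp add: sum.delta)
  finally show ?thesis
    using fourier_const_sq[where 'n='n] by (simp add: inverse_fourier_eq mult_ac)
qed

text \<open>Bessel's inequality. For a finite set \<open>X\<close> of lattice points let \<open>S\<close> be the corresponding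
  partial Fourier sum of \<open>g\<close>. By orthogonality the integral of \<open>|g - S|\<^sup>2\<close> is the integral of
  \<open>|g|\<^sup>2\<close> minus the sum of the squared coefficients over \<open>X\<close>, and it is nonnegative.
  Boundedness of \<open>g\<close> stands in for square integrability; all the functions that occur in the
  theorem are bounded.\<close>

lemma inverse_fourier_in_ell2:
  fixes g :: "real ^ 'n::finite \<Rightarrow> complex"
  assumes [measurable]: "g \<in> borel_measurable borel" and bound: "\<And>k. cmod (g k) \<le> B"
  shows "inverse_fourier g \<in> ell2"
proof -
  interpret finite_measure "torus_measure :: (real ^ 'n) measure"
    by (rule finite_torus_measure)
  let ?c = "fourier_const TYPE('n)" and ?M = "torus_measure :: (real ^ 'n) measure"
  let ?h = "inverse_fourier g"
  have B: "B \<ge> 0"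
    using bound[of 0] norm_ge_zero order_trans by blast
  have int_wave: "integrable ?M (wave m)" for m
    by (rule integrable_torus[of _ 1]) auto
  have int_g: "integrable ?M (\<lambda>k. g k * wave m k)" for m
    by (rule integrable_torus[of _ B]) (use bound in \<open>auto simp: norm_mult\<close>)
  have [measurable]: "(\<lambda>k. cnj (g k)) \<in> borel_measurable borel"
    by (rule borel_measurable_continuous_on[of cnj]) (auto intro: continuous_intros)
  have int_gg: "integrable ?M (\<lambda>k. g k * cnj (g k))"
    by (rule integrable_torus[of _ "B * B"])
      (use bound B in \<open>auto simp: norm_mult intro!: mult_mono\<close>)
  have bessel: "(\<Sum>x\<in>X. (cmod (?h x))\<^sup>2) \<le> (\<integral>k. (cmod (g k))\<^sup>2 \<partial>?M)" if "finite X" for X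
  proof -
    define S :: "real ^ 'n \<Rightarrow> complex" where "S k = (\<Sum>x\<in>X. ?c * ?h x * wave (- x) k)" for k
    define N where "N = (\<Sum>x\<in>X. (cmod (?h x))\<^sup>2)"
    have N: "complex_of_real N = (\<Sum>x\<in>X. ?h x * cnj (?h x))"
      by (simp only: N_def of_real_sum complex_norm_square)
    have cnjS: "cnj (S k) = (\<Sum>x\<in>X. ?c * cnj (?h x) * wave x k)" for k
      by (simp add: S_def flip: wave_minus)
    have [measurable]: "S \<in> borel_measurable borel"
      unfolding S_def by measurable
    have gS: "has_bochner_integral ?M (\<lambda>k. g k * cnj (S k)) N"
    proof -
      have "has_bochner_integral ?M (\<lambda>k. \<Sum>x\<in>X. ?c * cnj (?h x) * (g k * wave x k))
         (\<Sum>x\<in>X. ?c * cnj (?h x) * (\<integral>k. g k * wave x k \<partial>?M))"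
        by (intro has_bochner_integral_sum has_bochner_integral_mult_right
            has_bochner_integral_integrable int_g)
      then show ?thesis
        unfolding N by (simp add: cnjS sum_distrib_left mult_ac inverse_fourier_eq)
    qed
    have Sg: "has_bochner_integral ?M (\<lambda>k. S k * cnj (g k)) N"
      using has_bochner_integral_bounded_linear[OF bounded_linear_cnj gS] by (simp add: mult_ac)
    have SS: "has_bochner_integral ?M (\<lambda>k. S k * cnj (S k)) N"
    proof -
      have "has_bochner_integral ?M
          (\<lambda>k. \<Sum>x\<in>X. \<Sum>y\<in>X. ?c * ?c * ?h x * cnj (?h y) * wave (y - x) k)
          (\<Sum>x\<in>X. \<Sum>y\<in>X. ?c * ?c * ?h x * cnj (?h y) * (\<integral>k. wave (y - x) k \<partial>?M))"
        by (intro has_bochner_integral_sum has_bochner_integral_mult_right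
            has_bochner_integral_integrable int_wave)
      also have "(\<lambda>k. \<Sum>x\<in>X. \<Sum>y\<in>X. ?c * ?c * ?h x * cnj (?h y) * wave (y - x) k)
          = (\<lambda>k. S k * cnj (S k))"
      proof
        fix k :: "real ^ 'n"
        have "wave (y - x) k = wave (- x) k * wave y k" for x y :: "int ^ 'n"
          by (simp flip: wave_add)
        then show "(\<Sum>x\<in>X. \<Sum>y\<in>X. ?c * ?c * ?h x * cnj (?h y) * wave (y - x) k) = S k * cnj (S k)"
          unfolding cnjS unfolding S_def sum_product by (simp add: mult_ac)
      qed
      also have "(\<Sum>x\<in>X. \<Sum>y\<in>X. ?c * ?c * ?h x * cnj (?h y) * (\<integral>k. wave (y - x) k \<partial>?M))
          = (\<Sum>x\<in>X. \<Sum>y\<in>X. if y = x then (?c * ?c * of_real ((2 * pi) ^ CARD('n))) * (?h x * cnj (?h y)) else 0)"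
        by (intro sum.cong) (auto simp: integral_wave)
      also have "\<dots> = N"
        using \<open>finite X\<close> unfolding fourier_const_sq N by simp
      finally show ?thesis .
    qed
    have "has_bochner_integral ?M (\<lambda>k. g k * cnj (g k) - g k * cnj (S k) - S k * cnj (g k) + S k * cnj (S k))
      ((\<integral>k. g k * cnj (g k) \<partial>?M) - N - N + N)"
      by (intro has_bochner_integral_add has_bochner_integral_diff gS Sg SS
            has_bochner_integral_integrable int_gg)
    also have "(\<lambda>k. g k * cnj (g k) - g k * cnj (S k) - S k * cnj (g k) + S k * cnj (S k))
      = (\<lambda>k. complex_of_real ((cmod (g k - S k))\<^sup>2))"
      unfolding complex_norm_square by (simp add: algebra_simps)
    also have "(\<lambda>k. g k * cnj (g k)) = (\<lambda>k. complex_of_real ((cmod (g k))\<^sup>2))"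
      unfolding complex_norm_square ..
    finally have "(\<integral>k. complex_of_real ((cmod (g k - S k))\<^sup>2) \<partial>?M)
        = (\<integral>k. complex_of_real ((cmod (g k))\<^sup>2) \<partial>?M) - N"
      by (simp add: has_bochner_integral_integral_eq)
    then have "(\<integral>k. (cmod (g k - S k))\<^sup>2 \<partial>?M) = (\<integral>k. (cmod (g k))\<^sup>2 \<partial>?M) - N"
      unfolding integral_complex_of_real of_real_diff[symmetric] of_real_eq_iff .
    moreover have "(\<integral>k. (cmod (g k - S k))\<^sup>2 \<partial>?M) \<ge> 0"
      by (intro Bochner_Integration.integral_nonneg) simp
    ultimately show ?thesis
      by (simp add: N_def)
  qed
  show ?thesis
    unfolding ell2_def mem_Collect_eq
    by (rule nonneg_bdd_above_summable_on) (auto intro!: bdd_aboveI bessel)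
qed

section \<open>The discrete Laplacian and its resolvent\<close>

text \<open>Writing the Laplacian as a sum over a fixed set of translations makes it a convolution,
  on which the Fourier transform and the shift invariance of sums over the lattice act directly.\<close>

definition unit_steps :: "(int ^ 'n::finite) set" where
  "unit_steps = {m. norm (emb m) = 1}"

lemma discrete_laplacian_eq:
  "discrete_laplacian \<psi> x = (\<Sum>m\<in>unit_steps. \<psi> (x + m))"
  unfolding discrete_laplacian_def
proof (rule sum.reindex_bij_witness[of _ "\<lambda>m. x + m" "\<lambda>y. y - x"])
  have *: "emb y - emb x = emb (y - x)" for y
    by (simp add: emb_def vec_eq_iff)
  show "y - x \<in> unit_steps" if "y \<in> {x'. norm (emb x' - emb x) = 1}" for y
    using that by (simp add: unit_steps_def *)
  show "x + m \<in> {x'. norm (emb x' - emb x) = 1}" if "m \<in> unit_steps" for m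
    using that by (simp add: unit_steps_def emb_add)
qed auto

lemma unit_steps_eq:
  "(unit_steps :: (int ^ 'n::finite) set) = range (\<lambda>i. axis i 1) \<union> range (\<lambda>i. axis i (- 1))"
proof (intro equalityI subsetI)
  fix m :: "int ^ 'n" assume "m \<in> unit_steps"
  then have "(\<Sum>i\<in>UNIV. (real_of_int (m $ i))\<^sup>2) = 1"
    by (simp add: unit_steps_def emb_def norm_eq_sqrt_inner inner_vec_def power2_eq_square)
  then have "real_of_int (\<Sum>i\<in>UNIV. (m $ i)\<^sup>2) = real_of_int 1"
    by simp
  then have s: "(\<Sum>i\<in>UNIV. (m $ i)\<^sup>2) = 1"
    by (simp only: of_int_eq_iff)
  then obtain i where i: "m $ i \<noteq> 0"
    by (metis (no_types, lifting) sum.neutral zero_neq_one zero_power2)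
  have s': "(m $ i)\<^sup>2 + (\<Sum>j\<in>UNIV - {i}. (m $ j)\<^sup>2) = 1"
    using s by (subst (asm) sum.remove[of _ i]) auto
  have "(m $ i)\<^sup>2 \<ge> 1"
    using i by (simp add: int_one_le_iff_zero_less)
  moreover have nonneg: "(\<Sum>j\<in>UNIV - {i}. (m $ j)\<^sup>2) \<ge> 0"
    by (simp add: sum_nonneg)
  ultimately have "(\<Sum>j\<in>UNIV - {i}. (m $ j)\<^sup>2) = 0" "(m $ i)\<^sup>2 = 1"
    using s' by linarith+
  then have "\<forall>j. j \<noteq> i \<longrightarrow> m $ j = 0" "m $ i = 1 \<or> m $ i = - 1"
    by (auto simp: sum_nonneg_eq_0_iff power2_eq_1_iff)
  then have "m = axis i 1 \<or> m = axis i (- 1)"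
    by (auto simp: vec_eq_iff axis_def)
  then show "m \<in> range (\<lambda>i. axis i 1) \<union> range (\<lambda>i. axis i (- 1))"
    by auto
next
  have "emb (axis i 1 :: int ^ 'n) = axis i 1" "emb (axis i (-1) :: int ^ 'n) = axis i (-1)" for i
    by (auto simp: emb_def axis_def vec_eq_iff)
  then show "m \<in> unit_steps" if "m \<in> range (\<lambda>i. axis i 1) \<union> range (\<lambda>i. axis i (- 1))"
    for m :: "int ^ 'n"
    using that by (auto simp: unit_steps_def norm_eq_sqrt_inner inner_axis_axis)
qed

lemma finite_unit_steps [simp]: "finite (unit_steps :: (int ^ 'n::finite) set)"
  by (simp add: unit_steps_eq)

lemma sum_unit_steps_wave:
  fixes k :: "real ^ 'n::finite"
  shows "(\<Sum>m\<in>unit_steps. wave m k) = of_real (phi k)"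
proof -
  have emb1: "emb (axis i 1 :: int ^ 'n) = axis i 1" for i
    by (auto simp: emb_def axis_def vec_eq_iff)
  have neg: "axis i (-1) = - (axis i 1 :: int ^ 'n)" for i
    by (auto simp: axis_def vec_eq_iff)
  have "(axis i 1 :: int ^ 'n) \<noteq> axis j (-1)" for i j
    by (simp add: axis_eq_axis)
  then have "(\<Sum>m\<in>unit_steps. wave m k)
      = (\<Sum>m\<in>range (\<lambda>i. axis i 1). wave m k) + (\<Sum>m\<in>range (\<lambda>i. axis i (-1)). wave m k)"
    unfolding unit_steps_eq by (intro sum.union_disjoint) auto
  also have "\<dots> = (\<Sum>i\<in>UNIV. wave (axis i 1) k) + (\<Sum>i\<in>UNIV. wave (axis i (-1)) k)"
    by (simp add: sum.reindex inj_on_def axis_eq_axis)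
  also have "\<dots> = (\<Sum>i\<in>UNIV. wave (axis i 1) k + cnj (wave (axis i 1) k))"
    by (simp add: sum.distrib neg wave_minus)
  also have "\<dots> = (\<Sum>i\<in>UNIV. of_real (2 * cos (k $ i)))"
    by (intro sum.cong refl) (simp add: complex_add_cnj wave_def emb1 inner_axis Re_exp)
  also have "\<dots> = of_real (phi k)"
    by (simp add: phi_def sum_distrib_left)
  finally show ?thesis .
qed

text \<open>Shifting a lattice function by \<open>m\<close> multiplies its transform by \<open>wave m\<close>, and the waves of the
  unit steps add up to \<open>\<phi>\<close>. The constant \<open>z\<close> is complex, since the identity serves both for
  \<open>z = \<lambda>\<^sub>j\<close> and for the nonreal spectral parameter of the resolvent.\<close>

lemma inverse_fourier_mult_phi:
  fixes g :: "real ^ 'n::finite \<Rightarrow> complex"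
  assumes [measurable]: "g \<in> borel_measurable borel" and bound: "\<And>k. cmod (g k) \<le> B"
  shows "inverse_fourier (\<lambda>k. g k * (of_real (phi k) - z)) x
    = discrete_laplacian (inverse_fourier g) x - z * inverse_fourier g x"
proof -
  let ?M = "torus_measure :: (real ^ 'n) measure"
  have int_g: "integrable ?M (\<lambda>k. g k * wave m k)" for m
    by (rule integrable_torus[of _ B]) (use bound in \<open>auto simp: norm_mult\<close>)
  have "(\<integral>k. g k * (of_real (phi k) - z) * wave x k \<partial>?M)
    = (\<integral>k. (\<Sum>m\<in>unit_steps. g k * wave (x + m) k) - z * (g k * wave x k) \<partial>?M)"
    by (intro Bochner_Integration.integral_cong refl)
      (simp add: algebra_simps wave_add flip: sum_unit_steps_wave sum_distrib_left sum_distrib_right)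
  also have "\<dots> = (\<Sum>m\<in>unit_steps. \<integral>k. g k * wave (x + m) k \<partial>?M) - z * (\<integral>k. g k * wave x k \<partial>?M)"
    by (simp add: int_g)
  finally show ?thesis
    by (simp add: inverse_fourier_eq discrete_laplacian_eq ring_distribs sum_distrib_left)
qed

text \<open>The correlation \<open>I m\<close>, the inner product of the \<open>m\<close>-shift of \<open>\<psi>\<close> with \<open>\<psi>\<close>, satisfies
  \<open>I (- m) = cnj (I m)\<close>. The set of unit steps is symmetric, so the inner product of \<open>\<Delta>\<psi>\<close>
  with \<open>\<psi>\<close>, the sum of \<open>I\<close> over the unit steps, is real. It also equals \<open>\<nu> I 0\<close>, where
  \<open>I 0\<close> is the squared norm of \<open>\<psi>\<close>.\<close>

lemma no_nonreal_eigenfunction_ell2: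
  fixes \<psi> :: "int ^ 'n::finite \<Rightarrow> complex"
  assumes "\<psi> \<in> ell2" and eq: "\<And>x. discrete_laplacian \<psi> x = \<nu> * \<psi> x" and "Im \<nu> \<noteq> 0"
  shows "\<psi> = (\<lambda>_. 0)"
proof -
  have sq: "(\<lambda>x. (cmod (\<psi> x))\<^sup>2) summable_on UNIV"
    using assms by (simp add: ell2_def)
  have sqm: "(\<lambda>x. (cmod (\<psi> (x + m)))\<^sup>2) summable_on UNIV" for m
    using sq summable_on_reindex_bij_betw[of "\<lambda>x. x + m" UNIV UNIV "\<lambda>x. (cmod (\<psi> x))\<^sup>2"]
    by (simp add: bij_plus_right)
  have summ: "(\<lambda>x. \<psi> (x + m) * cnj (\<psi> x)) summable_on UNIV" for m
    by (rule abs_summable_summable, rule abs_summable_product)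
      (use sq sqm[of m] in \<open>simp_all add: norm_mult power2_eq_square\<close>)
  define I where "I m = (\<Sum>\<^sub>\<infinity>x. \<psi> (x + m) * cnj (\<psi> x))" for m
  have cnjI: "I (- m) = cnj (I m)" for m
    unfolding I_def infsum_cnj[symmetric]
    by (rule infsum_reindex_bij_witness[of _ "\<lambda>x. x + m" "\<lambda>x. x - m"]) auto
  have "((\<lambda>x. \<Sum>m\<in>F. \<psi> (x + m) * cnj (\<psi> x)) has_sum (\<Sum>m\<in>F. I m)) UNIV" if "finite F" for F
    using that
    by (induction F rule: finite_induct)
      (auto simp: I_def intro!: has_sum_add has_sum_infsum summ)
  from this[OF finite_unit_steps]
  have "((\<lambda>x. \<nu> * (\<psi> x * cnj (\<psi> x))) has_sum (\<Sum>m\<in>unit_steps. I m)) UNIV"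
    by (simp add: eq mult.assoc flip: sum_distrib_right discrete_laplacian_eq)
  moreover have "((\<lambda>x. \<nu> * (\<psi> x * cnj (\<psi> x))) has_sum (\<nu> * I 0)) UNIV"
    using summ[of 0] by (auto simp: I_def intro!: has_sum_cmult_right)
  ultimately have "\<nu> * I 0 = (\<Sum>m\<in>unit_steps. I m)"
    using has_sum_unique by blast
  moreover have "(\<Sum>m\<in>unit_steps. I m) = cnj (\<Sum>m\<in>unit_steps. I m)"
    unfolding cnj_sum
    by (rule sum.reindex_bij_witness[of _ uminus uminus])
      (auto simp: unit_steps_def emb_minus simp flip: cnjI)
  moreover have I0: "I 0 = of_real (\<Sum>\<^sub>\<infinity>x. (cmod (\<psi> x))\<^sup>2)"
    unfolding I_def add_0_right complex_norm_square[symmetric]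
    by (intro infsumI has_sum_of_real has_sum_infsum sq)
  ultimately have "Im (\<nu> * I 0) = 0"
    by (metis complex_is_Real_iff Reals_cnj_iff)
  with I0 \<open>Im \<nu> \<noteq> 0\<close> have "(\<Sum>\<^sub>\<infinity>x. (cmod (\<psi> x))\<^sup>2) = 0"
    by simp
  then have "(cmod (\<psi> x))\<^sup>2 = 0" for x
    by (intro nonneg_infsum_le_0D[of _ UNIV]) (auto intro: sq)
  then show ?thesis by auto
qed

lemma ell2_diff:
  assumes "\<psi> \<in> ell2" "\<eta> \<in> ell2"
  shows "(\<lambda>x. \<psi> x - \<eta> x) \<in> ell2"
proof -
  have "(\<lambda>x. 2 * (cmod (\<psi> x))\<^sup>2 + 2 * (cmod (\<eta> x))\<^sup>2) summable_on UNIV"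
    using assms by (intro summable_on_add summable_on_cmult_right) (auto simp: ell2_def)
  moreover have "(cmod (\<psi> x - \<eta> x))\<^sup>2 \<le> 2 * (cmod (\<psi> x))\<^sup>2 + 2 * (cmod (\<eta> x))\<^sup>2" for x
  proof -
    have "(cmod (\<psi> x - \<eta> x))\<^sup>2 \<le> (cmod (\<psi> x) + cmod (\<eta> x))\<^sup>2"
      by (intro power_mono norm_triangle_ineq4) simp
    also have "\<dots> \<le> 2 * (cmod (\<psi> x))\<^sup>2 + 2 * (cmod (\<eta> x))\<^sup>2"
      using sum_squares_bound[of "cmod (\<psi> x)" "cmod (\<eta> x)"] by (simp add: power2_sum)
    finally show ?thesis .
  qed
  ultimately show ?thesis
    unfolding ell2_def mem_Collect_eq by (rule summable_on_comparison_test) auto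
qed

text \<open>The resolvent is an inverse chosen on \<open>ell2\<close>, so once \<open>\<Delta> - \<nu>\<close> is known to be injective
  there, exhibiting one square summable solution computes it.\<close>

lemma resolvent_eqI:
  fixes f \<psi> :: "int ^ 'n::finite \<Rightarrow> complex"
  assumes "Im \<nu> \<noteq> 0" "\<psi> \<in> ell2" and "\<And>x. discrete_laplacian \<psi> x - \<nu> * \<psi> x = f x"
  shows "resolvent \<nu> f = \<psi>"
proof -
  have "inj_on (\<lambda>(\<psi> :: int ^ 'n \<Rightarrow> complex) x. discrete_laplacian \<psi> x - \<nu> * \<psi> x) ell2"
  proof (rule inj_onI)
    fix \<psi> \<eta> :: "int ^ 'n \<Rightarrow> complex"
    assume mem: "\<psi> \<in> ell2" "\<eta> \<in> ell2"
      and eq: "(\<lambda>x. discrete_laplacian \<psi> x - \<nu> * \<psi> x) = (\<lambda>x. discrete_laplacian \<eta> x - \<nu> * \<eta> x)"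
    have "discrete_laplacian (\<lambda>x. \<psi> x - \<eta> x) x = \<nu> * (\<psi> x - \<eta> x)" for x
      using fun_cong[OF eq, of x] by (simp add: discrete_laplacian_eq sum_subtractf algebra_simps)
    from no_nonreal_eigenfunction_ell2[OF ell2_diff[OF mem] this \<open>Im \<nu> \<noteq> 0\<close>]
    show "\<psi> = \<eta>"
      by (auto simp: fun_eq_iff)
  qed
  moreover have "f = (\<lambda>x. discrete_laplacian \<psi> x - \<nu> * \<psi> x)"
    using assms(3) by auto
  ultimately show ?thesis
    unfolding resolvent_def using inv_into_f_f assms(2) by fastforce
qed

section \<open>Finitely supported functions with prescribed factors\<close>

text \<open>The set of indices is a parameter so that a single factor can be split off.\<close>

definition transform_with_factors :: "(int ^ 'n::finite \<Rightarrow> complex) \<Rightarrow> (nat \<Rightarrow> real) \<Rightarrow> nat set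
    \<Rightarrow> real ^ 'n \<Rightarrow> complex" where
  "transform_with_factors u lam S k = fourier u k * (\<Prod>j\<in>S. of_real (phi k - lam j))"

lemma abs_phi_le: "\<bar>phi (k :: real ^ 'n::finite)\<bar> \<le> 2 * real CARD('n)"
proof -
  have "\<bar>\<Sum>i\<in>UNIV. cos (k $ i)\<bar> \<le> (\<Sum>i\<in>(UNIV :: 'n set). 1)"
    by (rule order_trans[OF sum_abs sum_mono]) simp
  then show ?thesis
    by (simp add: phi_def)
qed

lemma transform_with_factors_measurable:
  assumes "finite {x. u x \<noteq> 0}"
  shows "transform_with_factors u lam S \<in> borel_measurable borel"
proof -
  show ?thesis
    unfolding transform_with_factors_def fourier_eq[OF assms] by measurable
qed

lemma transform_with_factors_bounded:
  fixes u :: "int ^ 'n::finite \<Rightarrow> complex"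
  assumes "finite {x. u x \<noteq> 0}"
  shows "\<exists>B. \<forall>k. cmod (transform_with_factors u lam S k) \<le> B"
proof (intro exI allI)
  fix k
  have "cmod (fourier u k) \<le> cmod (fourier_const TYPE('n)) * (\<Sum>x | u x \<noteq> 0. cmod (u x))"
    unfolding fourier_eq[OF assms] norm_mult
    by (intro mult_left_mono order_trans[OF norm_sum sum_mono]) (auto simp: norm_mult)
  moreover have "cmod (\<Prod>j\<in>S. of_real (phi k - lam j)) \<le> (\<Prod>j\<in>S. 2 * real CARD('n) + \<bar>lam j\<bar>)"
    unfolding prod_norm[symmetric]
    by (intro prod_mono) (use abs_phi_le[of k] in \<open>auto simp flip: of_real_diff\<close>)
  ultimately show "cmod (transform_with_factors u lam S k)
      \<le> cmod (fourier_const TYPE('n)) * (\<Sum>x | u x \<noteq> 0. cmod (u x)) * (\<Prod>j\<in>S. 2 * real CARD('n) + \<bar>lam j\<bar>)"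
    unfolding transform_with_factors_def norm_mult by (intro mult_mono) (auto intro!: mult_nonneg_nonneg sum_nonneg)
qed

lemma transform_with_factors_insert:
  assumes "finite S" "j \<notin> S"
  shows "transform_with_factors u lam (insert j S) = (\<lambda>k. transform_with_factors u lam S k * (of_real (phi k) - of_real (lam j)))"
  using assms by (simp add: transform_with_factors_def fun_eq_iff)

lemma finite_support_discrete_laplacian:
  fixes \<psi> :: "int ^ 'n::finite \<Rightarrow> complex"
  assumes "finite {x. \<psi> x \<noteq> 0}"
  shows "finite {x. discrete_laplacian \<psi> x - z * \<psi> x \<noteq> 0}"
proof (rule finite_subset)
  let ?T = "{x. \<psi> x \<noteq> 0} \<union> (\<Union>m\<in>unit_steps. (\<lambda>y. y - m) ` {x. \<psi> x \<noteq> 0})"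
  show "finite ?T"
    using assms by simp
  show "{x. discrete_laplacian \<psi> x - z * \<psi> x \<noteq> 0} \<subseteq> ?T"
  proof
    fix x assume x: "x \<in> {x. discrete_laplacian \<psi> x - z * \<psi> x \<noteq> 0}"
    show "x \<in> ?T"
    proof (rule ccontr)
      assume "x \<notin> ?T"
      moreover have "x = (x + m) - m" for m by simp
      ultimately have "\<psi> x = 0" "\<forall>m\<in>unit_steps. \<psi> (x + m) = 0"
        by blast+
      with x show False by (simp add: discrete_laplacian_eq)
    qed
  qed
qed

text \<open>Induction on the index set: each new factor \<open>\<phi> - \<lambda>\<^sub>j\<close> applies \<open>\<Delta> - \<lambda>\<^sub>j\<close>
  on the lattice, starting from \<open>u\<close> itself by Fourier inversion.\<close>

lemma finite_support_inverse_fourier: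
  assumes fin: "finite {x. u x \<noteq> 0}" and "finite S"
  shows "finite {x. inverse_fourier (transform_with_factors u lam S) x \<noteq> 0}"
  using \<open>finite S\<close>
proof (induction rule: finite_induct)
  case empty
  then show ?case
    using fin by (simp add: transform_with_factors_def[abs_def] inverse_fourier_fourier)
next
  case (insert j S)
  obtain B where B: "\<And>k. cmod (transform_with_factors u lam S k) \<le> B"
    using transform_with_factors_bounded[OF fin] by blast
  have "inverse_fourier (transform_with_factors u lam (insert j S)) x
      = discrete_laplacian (inverse_fourier (transform_with_factors u lam S)) x
        - of_real (lam j) * inverse_fourier (transform_with_factors u lam S) x" for x
    using inverse_fourier_mult_phi[OF transform_with_factors_measurable[OF fin] B] insert
    by (simp add: transform_with_factors_insert)
  with finite_support_discrete_laplacian[OF insert.IH] show ?case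
    by simp
qed

section \<open>The limiting absorption solutions\<close>

text \<open>Applied to the function with transform \<open>g (\<phi> - c)\<close>, the resolvent at \<open>c + \<i>s\<epsilon>\<close>
  produces the function with transform \<open>G \<epsilon>\<close>, which is \<open>g\<close> times
  \<open>(\<phi> - c) / (\<phi> - c - \<i>s\<epsilon>)\<close>. This factor has modulus at most 1, because the
  denominator has the numerator as its real part, and it converges to 1 wherever \<open>\<phi> \<noteq> c\<close>, that is,
  almost everywhere.\<close>

lemma is_limit_solution_inverse_fourier:
  fixes g :: "real ^ 'n::finite \<Rightarrow> complex"
  assumes [measurable]: "g \<in> borel_measurable borel" and bound: "\<And>k. cmod (g k) \<le> B"
    and s: "s \<in> {-1, 1}"
  shows "is_limit_solution s c (inverse_fourier (\<lambda>k. g k * (of_real (phi k) - of_real c))) (inverse_fourier g)"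
proof -
  let ?f = "inverse_fourier (\<lambda>k. g k * (of_real (phi k) - of_real c))"
  let ?M = "torus_measure :: (real ^ 'n) measure"
  define G where "G \<epsilon> k = g k * (of_real (phi k) - of_real c) / (of_real (phi k) - Complex c (s * \<epsilon>))"
    for \<epsilon> k
  have G_meas [measurable]: "G \<epsilon> \<in> borel_measurable borel" for \<epsilon>
    unfolding G_def by measurable
  have G_bound: "cmod (G \<epsilon> k) \<le> B" for \<epsilon> k
  proof -
    have "of_real (phi k) - Complex c (s * \<epsilon>) = Complex (phi k - c) (- s * \<epsilon>)"
      by (simp add: complex_eq_iff)
    then have "cmod (of_real (phi k) - of_real c) \<le> cmod (of_real (phi k) - Complex c (s * \<epsilon>))"
      using abs_Re_le_cmod[of "Complex (phi k - c) (- s * \<epsilon>)"] by (simp flip: of_real_diff)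
    then have "cmod ((of_real (phi k) - of_real c) / (of_real (phi k) - Complex c (s * \<epsilon>))) \<le> 1"
      by (simp add: norm_divide divide_le_eq_1)
    then have "cmod (g k) * cmod ((of_real (phi k) - of_real c) / (of_real (phi k) - Complex c (s * \<epsilon>))) \<le> B * 1"
      by (intro mult_mono bound) (use bound[of k] order_trans[OF norm_ge_zero] in auto)
    then show ?thesis
      by (simp add: G_def norm_mult norm_divide)
  qed
  have res: "resolvent (Complex c (s * \<epsilon>)) ?f = inverse_fourier (G \<epsilon>)" if "\<epsilon> > 0" for \<epsilon>
  proof (rule resolvent_eqI)
    have im: "s * \<epsilon> \<noteq> 0"
      using s that by auto
    then show "Im (Complex c (s * \<epsilon>)) \<noteq> 0"
      by simp
    show "inverse_fourier (G \<epsilon>) \<in> ell2"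
      by (rule inverse_fourier_in_ell2[OF G_meas G_bound])
    have "of_real (phi k) - Complex c (s * \<epsilon>) \<noteq> 0" for k :: "real ^ 'n"
      using im by (simp add: complex_eq_iff)
    then have "(\<lambda>k. G \<epsilon> k * (of_real (phi k) - Complex c (s * \<epsilon>)))
        = (\<lambda>k. g k * (of_real (phi k) - of_real c))"
      by (simp add: G_def)
    then show "discrete_laplacian (inverse_fourier (G \<epsilon>)) x - Complex c (s * \<epsilon>) * inverse_fourier (G \<epsilon>) x
        = ?f x" for x
      using inverse_fourier_mult_phi[OF G_meas G_bound, of \<epsilon> "Complex c (s * \<epsilon>)" x] by simp
  qed
  have lim: "((\<lambda>\<epsilon>. inverse_fourier (G \<epsilon>) x) \<longlongrightarrow> inverse_fourier g x) (at_right 0)" for x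
    unfolding inverse_fourier_eq
  proof (intro tendsto_mult_left tendsto_at_right_sequentially[of 0 1])
    fix \<epsilon> :: "nat \<Rightarrow> real"
    assume "\<epsilon> \<longlonglongrightarrow> 0"
    show "(\<lambda>n. \<integral>k. G (\<epsilon> n) k * wave x k \<partial>?M) \<longlonglongrightarrow> (\<integral>k. g k * wave x k \<partial>?M)"
    proof (rule integral_dominated_convergence[where w = "\<lambda>_. B"])
      show "integrable ?M (\<lambda>_. B)"
        using finite_measure.integrable_const[OF finite_torus_measure] .
      show "AE k in ?M. cmod (G (\<epsilon> n) k * wave x k) \<le> B" for n
        by (simp add: norm_mult G_bound)
      show "AE k in ?M. (\<lambda>n. G (\<epsilon> n) k * wave x k) \<longlonglongrightarrow> g k * wave x k"
        using level_set_null[of c]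
      proof eventually_elim
        case (elim k)
        have "(\<lambda>n. Complex c (s * \<epsilon> n)) \<longlonglongrightarrow> Complex c (s * 0)"
          by (intro tendsto_Complex tendsto_const tendsto_mult_left \<open>\<epsilon> \<longlonglongrightarrow> 0\<close>)
        then have "(\<lambda>n. Complex c (s * \<epsilon> n)) \<longlonglongrightarrow> of_real c"
          by (simp add: complex_of_real_def)
        moreover have "of_real (phi k) - of_real c \<noteq> (0 :: complex)"
          using elim by (simp flip: of_real_diff)
        ultimately have "(\<lambda>n. G (\<epsilon> n) k) \<longlonglongrightarrow> g k * (of_real (phi k) - of_real c) / (of_real (phi k) - of_real c)"
          unfolding G_def by (intro tendsto_divide tendsto_diff tendsto_const)
        with \<open>of_real (phi k) - of_real c \<noteq> (0 :: complex)\<close> have "(\<lambda>n. G (\<epsilon> n) k) \<longlonglongrightarrow> g k"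
          by simp
        then show ?case
          by (intro tendsto_mult_right)
      qed
    qed (auto intro!: measurable_restrict_space1)
  qed auto
  show ?thesis
    unfolding is_limit_solution_def
  proof
    fix x
    have "\<forall>\<^sub>F \<epsilon> in at_right 0. inverse_fourier (G \<epsilon>) x = resolvent (Complex c (s * \<epsilon>)) ?f x"
      using eventually_at_right_less[of 0] by eventually_elim (simp add: res)
    with lim show "((\<lambda>\<epsilon>. resolvent (Complex c (s * \<epsilon>)) ?f x) \<longlongrightarrow> inverse_fourier g x) (at_right 0)"
      by (rule Lim_transform_eventually)
  qed
qed

section \<open>Far-field amplitudes of finitely supported solutions\<close>

lemma finite_support_eventually_zero:
  fixes v :: "int ^ 'n::finite \<Rightarrow> complex"
  assumes "finite {x. v x \<noteq> 0}"
  shows "\<forall>\<^sub>F x in filtercomap (\<lambda>x. norm (emb x)) at_top. v x = 0"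
proof -
  let ?R = "Max (insert 0 ((\<lambda>x. norm (emb x)) ` {x. v x \<noteq> 0}))"
  have "norm (emb x) \<le> ?R" if "v x \<noteq> 0" for x
    using assms that by (intro Max_ge) auto
  then have zero: "v x = 0" if "norm (emb x) > ?R" for x
    using that not_less by blast
  have "\<forall>\<^sub>F x in filtercomap (\<lambda>x :: int ^ 'n. norm (emb x)) at_top. norm (emb x) > ?R"
    by (rule eventually_filtercomapI) (rule eventually_gt_at_top)
  then show ?thesis
    by (rule eventually_mono) (rule zero)
qed

lemma far_field_amplitude_finite_support:
  fixes v :: "int ^ 'n::finite \<Rightarrow> complex"
  assumes lim: "is_limit_solution s c f v" and fin: "finite {x. v x \<noteq> 0}"
  shows "is_far_field_amplitude s c f (\<lambda>_. 0)"
  unfolding is_far_field_amplitude_def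
proof (intro conjI exI)
  show "is_limit_solution s c f v" by fact
  show "(\<lambda>x. v x -
          (let r = norm (emb x); \<omega> = emb x /\<^sub>R r in
             exp (\<i> * of_real (s * mu \<omega> c * r)) / of_real (r powr ((real CARD('n) - 1) / 2)) * 0))
       \<in> O[filtercomap (\<lambda>x. norm (emb x)) at_top](
           \<lambda>x. of_real (norm (emb x) powr (- (real CARD('n) + 1) / 2)))"
    \<comment> \<open>With amplitude 0 the remainder is \<open>v\<close>, which vanishes far out.\<close>
  proof (rule bigoI[of _ 1], rule eventually_mono[OF finite_support_eventually_zero[OF fin]])
  qed (simp add: Let_def)
qed simp

text \<open>The points obtained by rounding \<open>n \<omega>\<close> down in each coordinate stay at bounded distance from
  \<open>n \<omega>\<close>, so they go to infinity and their directions converge to \<open>\<omega>\<close>.\<close>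

lemma lattice_direction_limit:
  fixes \<omega> :: "real ^ 'n::finite"
  assumes "norm \<omega> = 1"
  obtains X :: "nat \<Rightarrow> int ^ 'n" where
    "filterlim (\<lambda>n. norm (emb (X n))) at_top sequentially"
    "(\<lambda>n. emb (X n) /\<^sub>R norm (emb (X n))) \<longlonglongrightarrow> \<omega>"
proof -
  define X :: "nat \<Rightarrow> int ^ 'n" where "X n = (\<chi> i. \<lfloor>real n * \<omega> $ i\<rfloor>)" for n
  have comp: "(\<lambda>n. real_of_int \<lfloor>real n * t\<rfloor> / real n) \<longlonglongrightarrow> t" for t :: real
  proof (rule LIMSEQ_I)
    fix e :: real assume "e > 0"
    obtain N :: nat where N: "1 / e < real N" using reals_Archimedean2 by blast
    show "\<exists>N. \<forall>n\<ge>N. norm (real_of_int \<lfloor>real n * t\<rfloor> / real n - t) < e"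
    proof (intro exI[of _ "Suc N"] allI impI)
      fix n assume "n \<ge> Suc N"
      then have n: "real n > 0" "real n > 1 / e"
        using N by linarith+
      have "real_of_int \<lfloor>real n * t\<rfloor> / real n - t = (real_of_int \<lfloor>real n * t\<rfloor> - real n * t) / real n"
        using n by (simp add: field_simps)
      moreover have "\<bar>real_of_int \<lfloor>real n * t\<rfloor> - real n * t\<bar> \<le> 1"
        by linarith
      ultimately have "norm (real_of_int \<lfloor>real n * t\<rfloor> / real n - t) \<le> 1 / real n"
        using n by (simp add: divide_right_mono)
      also have "1 / real n < e"
        using n \<open>e > 0\<close> by (simp add: field_simps)
      finally show "norm (real_of_int \<lfloor>real n * t\<rfloor> / real n - t) < e" .
    qed
  qed
  have lim: "(\<lambda>n. emb (X n) /\<^sub>R real n) \<longlonglongrightarrow> \<omega>"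
  proof (rule vec_tendstoI)
    show "(\<lambda>n. (emb (X n) /\<^sub>R real n) $ i) \<longlonglongrightarrow> \<omega> $ i" for i
      using comp[of "\<omega> $ i"] by (simp add: emb_def X_def divide_inverse mult.commute)
  qed
  then have nlim: "(\<lambda>n. norm (emb (X n) /\<^sub>R real n)) \<longlonglongrightarrow> 1"
    using tendsto_norm[OF lim] assms by simp
  have "filterlim (\<lambda>n. norm (emb (X n) /\<^sub>R real n) * real n) at_top sequentially"
    by (rule filterlim_tendsto_pos_mult_at_top[OF nlim _ filterlim_real_sequentially]) simp
  then have "filterlim (\<lambda>n. norm (emb (X n))) at_top sequentially"
    by (rule filterlim_cong[THEN iffD1, rotated -1])
      (auto intro!: eventually_mono[OF eventually_gt_at_top[of 0]])
  moreover have "(\<lambda>n. emb (X n) /\<^sub>R norm (emb (X n))) \<longlonglongrightarrow> \<omega>"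
  proof (rule Lim_transform_eventually)
    show "(\<lambda>n. (emb (X n) /\<^sub>R real n) /\<^sub>R norm (emb (X n) /\<^sub>R real n)) \<longlonglongrightarrow> \<omega>"
      using tendsto_scaleR[OF tendsto_inverse[OF nlim] lim] by simp
    show "\<forall>\<^sub>F n in sequentially. (emb (X n) /\<^sub>R real n) /\<^sub>R norm (emb (X n) /\<^sub>R real n)
        = emb (X n) /\<^sub>R norm (emb (X n))"
      by (rule eventually_mono[OF eventually_gt_at_top[of 0]]) auto
  qed
  ultimately show ?thesis
    by (rule that)
qed

text \<open>Limits are unique, so the limit solution in the definition of an amplitude is \<open>v\<close>. Far out,
  where \<open>v\<close> vanishes, only the leading term is left, and the error bound reads
  \<open>|a (x/|x|)| |x| powr (-(d-1)/2) \<le> C |x| powr (-(d+1)/2)\<close>. Hence \<open>a (x/|x|)\<close> is at most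
  \<open>C/|x|\<close>, because the exponential has modulus 1.\<close>

lemma far_field_amplitude_zero:
  fixes a :: "real ^ 'n::finite \<Rightarrow> complex"
  assumes lim: "is_limit_solution s c f v" and fin: "finite {x. v x \<noteq> 0}"
    and amp: "is_far_field_amplitude s c f a" and \<omega>: "\<omega> \<in> sphere 0 1"
  shows "a \<omega> = 0"
proof -
  let ?F = "filtercomap (\<lambda>x :: int ^ 'n. norm (emb x)) at_top"
  let ?d = "real CARD('n)"
  let ?t = "\<lambda>x. let r = norm (emb x); \<omega> = emb x /\<^sub>R r in
             exp (\<i> * of_real (s * mu \<omega> c * r)) / of_real (r powr ((?d - 1) / 2)) * a \<omega>"
  obtain \<psi> where \<psi>: "is_limit_solution s c f \<psi>"
    and O: "(\<lambda>x. \<psi> x - ?t x) \<in> O[?F](\<lambda>x. of_real (norm (emb x) powr (- (?d + 1) / 2)))"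
    and cont: "continuous_on (sphere 0 1) a"
    using amp unfolding is_far_field_amplitude_def by blast
  have "\<psi> = v"
    using \<psi> lim tendsto_unique[OF trivial_limit_at_right_real]
    unfolding is_limit_solution_def by blast
  obtain C where C: "\<forall>\<^sub>F x in ?F. cmod (\<psi> x - ?t x) \<le> C * cmod (of_real (norm (emb x) powr (- (?d + 1) / 2)))"
    using O by (elim landau_o.bigE)
  have "\<forall>\<^sub>F x in ?F. norm (emb x) > 0"
    by (rule eventually_filtercomapI) (rule eventually_gt_at_top)
  with C finite_support_eventually_zero[OF fin]
  have ev: "\<forall>\<^sub>F x in ?F. norm (emb x) > 0 \<and> cmod (a (emb x /\<^sub>R norm (emb x))) \<le> C / norm (emb x)"
  proof eventually_elim
    case (elim x)
    define r where "r = norm (emb x)"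
    have r: "r > 0"
      using elim r_def by simp
    have "cmod (?t x) = cmod (a (emb x /\<^sub>R r)) / r powr ((?d - 1) / 2)"
      by (simp add: Let_def r_def norm_mult norm_divide)
    then have "cmod (a (emb x /\<^sub>R r)) / r powr ((?d - 1) / 2) \<le> C * r powr (- (?d + 1) / 2)"
      using elim by (simp add: \<open>\<psi> = v\<close> r_def)
    then have "cmod (a (emb x /\<^sub>R r)) \<le> C * (r powr (- (?d + 1) / 2) * r powr ((?d - 1) / 2))"
      using r by (simp add: pos_divide_le_eq)
    also have "r powr (- (?d + 1) / 2) * r powr ((?d - 1) / 2) = r powr (- 1)"
      unfolding powr_add[symmetric] by (simp add: field_simps)
    finally show ?case
      using r by (simp add: r_def powr_minus divide_inverse)
  qed
  obtain X :: "nat \<Rightarrow> int ^ 'n" where X: "filterlim (\<lambda>n. norm (emb (X n))) at_top sequentially"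
    and X_lim: "(\<lambda>n. emb (X n) /\<^sub>R norm (emb (X n))) \<longlonglongrightarrow> \<omega>"
    using lattice_direction_limit[of \<omega>] \<omega> by auto
  have "filterlim X ?F sequentially"
    using X by (simp add: filterlim_filtercomap_iff o_def)
  with ev have evX: "\<forall>\<^sub>F n in sequentially. norm (emb (X n)) > 0 \<and>
      cmod (a (emb (X n) /\<^sub>R norm (emb (X n)))) \<le> C / norm (emb (X n))"
    unfolding filterlim_iff by blast
  have "(\<lambda>n. C / norm (emb (X n))) \<longlonglongrightarrow> 0"
    by (rule tendsto_divide_0[OF tendsto_const filterlim_at_top_imp_at_infinity[OF X]])
  then have "(\<lambda>n. a (emb (X n) /\<^sub>R norm (emb (X n)))) \<longlonglongrightarrow> 0"
    by (rule Lim_null_comparison[rotated]) (use evX in \<open>auto elim: eventually_mono\<close>)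
  moreover have "(\<lambda>n. a (emb (X n) /\<^sub>R norm (emb (X n)))) \<longlonglongrightarrow> a \<omega>"
  proof (rule continuous_on_tendsto_compose[OF cont X_lim \<omega>])
    show "\<forall>\<^sub>F n in sequentially. emb (X n) /\<^sub>R norm (emb (X n)) \<in> sphere 0 1"
      using evX by eventually_elim auto
  qed
  ultimately show ?thesis
    using LIMSEQ_unique by blast
qed

theorem theorem2p2:
  fixes u f :: "int ^ 'n::finite \<Rightarrow> complex" and J :: nat and lam :: "nat \<Rightarrow> real"
  assumes "finite {x. u x \<noteq> 0}"
    and "J \<ge> 1"
    and "\<forall>j\<in>{1..J}. lam j \<in> Lambda CARD('n)"
    and "f = inverse_fourier (\<lambda>k. fourier u k * (\<Prod>j=1..J. of_real (phi k - lam j)))"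
  shows "finite {x. f x \<noteq> 0} \<and>
    (\<forall>j\<in>{1..J}. \<forall>s\<in>{-1, 1}.
       (\<exists>a. is_far_field_amplitude s (lam j) f a) \<and>
       (\<forall>a. is_far_field_amplitude s (lam j) f a \<longrightarrow> (\<forall>\<omega>\<in>sphere 0 1. a \<omega> = 0)))"
proof (intro conjI ballI)
  note fin = assms(1)
  have f: "f = inverse_fourier (transform_with_factors u lam {1..J})"
    using assms(4) by (simp add: transform_with_factors_def[abs_def])
  show "finite {x. f x \<noteq> 0}"
    unfolding f by (rule finite_support_inverse_fourier[OF fin]) simp
  fix j and s :: real assume j: "j \<in> {1..J}" and s: "s \<in> {-1, 1}"
  \<comment> \<open>Split off the factor \<open>\<phi> - \<lambda>\<^sub>j\<close>: what remains is the transform of the limit solution.\<close>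
  define S where "S = {1..J} - {j}"
  define v where "v = inverse_fourier (transform_with_factors u lam S)"
  obtain B where B: "\<And>k. cmod (transform_with_factors u lam S k) \<le> B"
    using transform_with_factors_bounded[OF fin] by blast
  have "insert j S = {1..J}"
    using j by (auto simp: S_def)
  then have "f = inverse_fourier (\<lambda>k. transform_with_factors u lam S k * (of_real (phi k) - of_real (lam j)))"
    using transform_with_factors_insert[of S j u lam] by (simp add: f S_def)
  then have lim: "is_limit_solution s (lam j) f v"
    unfolding v_def using is_limit_solution_inverse_fourier[OF transform_with_factors_measurable[OF fin] B s] by simp
  have fin_v: "finite {x. v x \<noteq> 0}"
    unfolding v_def by (rule finite_support_inverse_fourier[OF fin]) (simp add: S_def)
  show "\<exists>a. is_far_field_amplitude s (lam j) f a"
    using far_field_amplitude_finite_support[OF lim fin_v] by blast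
  show "\<forall>a. is_far_field_amplitude s (lam j) f a \<longrightarrow> (\<forall>\<omega>\<in>sphere 0 1. a \<omega> = 0)"
    using far_field_amplitude_zero[OF lim fin_v] by blast
qed

end
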